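(* Let $G$ be a finite group and let $H$ be a nontrivial normal subgroup of $G$ with $|G/H|=n$. Then the number of edges of the normal subgroup based power graph $\Gamma_H(G)$ is $$(t-n+1)|H|^2+\binom{|H|}{2}\left(\frac{|G|}{|H|}-1\right)+(|G|-|H|),$$ where $t=\frac{1}{2}\sum_{aH\in G/H}\bigl(2\,o(aH)-\phi(o(aH))-1\bigr)$.
   Context: For a finite group $G$ with identity $e$ and a normal subgroup $H$ of $G$, the normal subgroup based power graph $\Gamma_H(G)$ is the simple undirected graph with vertex set $V(\Gamma_H(G))=(G\setminus H)\cup\{e\}$, in which two distinct vertices $x,y$ are adjacent if and only if $xH=y^mH$ or $yH=x^nH$ for some $m,n\in\mathbb{N}$. Here $\mathbb{N}$ denotes the positive integers. $o(aH)$ denotes the order of the element $aH$ in the quotient group $G/H$, and $\phi$ is Euler's totient function. Nontrivial means $H\neq\{e\}$. *)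

theory Defs
  imports "HOL-Algebra.Algebra" "HOL-Number_Theory.Totient"
begin

text \<open>The normal subgroup based power graph of a group \<open>G\<close> with respect to a normal subgroup
  \<open>H\<close>: \<open>nsb_verts\<close> is its vertex set, \<open>nsb_adj\<close> its adjacency relation, \<open>nsb_edges\<close> its edge set,
  with each undirected edge encoded as the two-element set of its endpoints.\<close>

definition nsb_verts :: "('a, 'b) monoid_scheme \<Rightarrow> 'a set \<Rightarrow> 'a set" where
  "nsb_verts G H = (carrier G - H) \<union> {\<one>\<^bsub>G\<^esub>}"

definition nsb_adj :: "('a, 'b) monoid_scheme \<Rightarrow> 'a set \<Rightarrow> 'a \<Rightarrow> 'a \<Rightarrow> bool" where
  "nsb_adj G H x y \<longleftrightarrow> x \<noteq> y \<and>
     ((\<exists>m::nat. m > 0 \<and> x <#\<^bsub>G\<^esub> H = (y [^]\<^bsub>G\<^esub> m) <#\<^bsub>G\<^esub> H) \<or>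
      (\<exists>n::nat. n > 0 \<and> y <#\<^bsub>G\<^esub> H = (x [^]\<^bsub>G\<^esub> n) <#\<^bsub>G\<^esub> H))"

definition nsb_edges :: "('a, 'b) monoid_scheme \<Rightarrow> 'a set \<Rightarrow> 'a set set" where
  "nsb_edges G H = {{x, y} | x y. x \<in> nsb_verts G H \<and> y \<in> nsb_verts G H \<and> nsb_adj G H x y}"

end

theory Submission
  imports Defs
begin

text \<open>Count adjacent ordered pairs. The identity contributes its \<open>|G| - |H|\<close> neighbours twice.
  Adjacency of two vertices outside \<open>H\<close> depends only on their cosets, up to excluding equal
  vertices, so these vertices contribute \<open>|H|\<^sup>2\<close> pairs for every pair of nontrivial cosets one of
  which is a power of the other, minus the diagonal. In a finite group an element \<open>a\<close> has
  \<open>ord a\<close> powers, \<open>totient (ord a)\<close> of which have \<open>a\<close> as a power in turn; inclusion-exclusion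
  then counts the pairs of cosets.\<close>

text \<open>The identity is left out because in the quotient it stands for \<open>H\<close>, which
  contributes only one vertex. Loops \<open>(a, a)\<close> are kept: distinct vertices in the same
  nontrivial coset are adjacent.\<close>

definition power_rel :: "('a, 'b) monoid_scheme \<Rightarrow> ('a \<times> 'a) set" where
  "power_rel G = {(a, b). a \<in> carrier G - {\<one>\<^bsub>G\<^esub>} \<and> b \<in> carrier G - {\<one>\<^bsub>G\<^esub>} \<and>
     (\<exists>m::nat. m > 0 \<and> b = a [^]\<^bsub>G\<^esub> m)}"

text \<open>Every fibre of the map from \<open>(x, y)\<close> to \<open>{x, y}\<close> has exactly
  two elements: symmetry supplies both orders, irreflexivity makes them different.\<close>

lemma card_sym_irrefl:
  assumes "finite P" "sym P" "irrefl P"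
  shows "card P = 2 * card {{x, y} | x y. (x, y) \<in> P}"
proof -
  let ?E = "{{x, y} | x y. (x, y) \<in> P}"
  have E: "?E = (\<lambda>(x, y). {x, y}) ` P" by auto
  have fin: "finite {p \<in> P. (\<lambda>(x, y). {x, y}) p = e}" for e using assms(1) by simp
  have P: "P = (\<Union>e\<in>?E. {p \<in> P. (\<lambda>(x, y). {x, y}) p = e})" unfolding E by blast
  have two: "card {p \<in> P. (\<lambda>(x, y). {x, y}) p = e} = 2" if "e \<in> ?E" for e
  proof -
    from that obtain x y where xy: "e = {x, y}" "(x, y) \<in> P" by blast
    with assms have "{p \<in> P. (\<lambda>(x, y). {x, y}) p = e} = {(x, y), (y, x)}" "x \<noteq> y"
      by (auto simp: doubleton_eq_iff irrefl_def dest: symD)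
    then show ?thesis by simp
  qed
  have "card P = (\<Sum>e\<in>?E. card {p \<in> P. (\<lambda>(x, y). {x, y}) p = e})"
    by (subst P, subst card_UN_disjoint) (use assms(1) E fin in auto)
  also have "\<dots> = 2 * card ?E" using two by simp
  finally show ?thesis .
qed

section \<open>Powers in a group and the count of related pairs\<close>

context group
begin

text \<open>Infinite order is covered as well: there \<open>ord a = 0\<close> and
  \<open>k mod 0 = k\<close>.\<close>

lemma nat_pow_mod_ord:
  assumes "a \<in> carrier G"
  shows "a [^] (k mod ord a) = a [^] (k::nat)"
proof -
  have "a [^] k = a [^] (ord a * (k div ord a) + k mod ord a)" by simp
  also have "\<dots> = (a [^] ord a) [^] (k div ord a) \<otimes> a [^] (k mod ord a)"
    using assms by (simp only: nat_pow_mult nat_pow_pow nat_pow_closed)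
  finally show ?thesis using assms by simp
qed

text \<open>Exponents may be reduced modulo \<open>ord a\<close>; the residue 0 gives exactly the
  excluded identity, so the range starts at 1.\<close>

lemma nontrivial_powers:
  assumes "finite (carrier G)" "a \<in> carrier G"
  shows "{b \<in> carrier G - {\<one>}. \<exists>m::nat. m > 0 \<and> b = a [^] m} = (\<lambda>k. a [^] k) ` {1..<ord a}"
proof (intro Set.set_eqI iffI)
  fix b assume "b \<in> {b \<in> carrier G - {\<one>}. \<exists>m::nat. m > 0 \<and> b = a [^] m}"
  then obtain m :: nat where m: "b = a [^] m" "b \<noteq> \<one>" by blast
  have "a [^] (m mod ord a) = b" using nat_pow_mod_ord assms m by simp
  moreover have "m mod ord a < ord a" using ord_ge_1[OF assms] by simp
  moreover have "m mod ord a \<noteq> 0" using m assms(2) pow_eq_id by (auto simp: dvd_eq_mod_eq_0)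
  ultimately show "b \<in> (\<lambda>k. a [^] k) ` {1..<ord a}" by (auto intro!: image_eqI)
next
  fix b assume "b \<in> (\<lambda>k. a [^] k) ` {1..<ord a}"
  then obtain k where k: "b = a [^] k" "0 < k" "k < ord a" by auto
  then have "b \<noteq> \<one>" using assms(2) by (auto simp: pow_eq_id dest: nat_dvd_not_less)
  with k show "b \<in> {b \<in> carrier G - {\<one>}. \<exists>m::nat. m > 0 \<and> b = a [^] m}"
    using assms(2) nat_pow_closed by blast
qed

text \<open>Both sides say that \<open>a\<close> and its \<open>k\<close>-th power generate the same
  cyclic subgroup. Forwards, their orders divide each other; backwards, an inverse of
  \<open>k\<close> modulo \<open>ord a\<close> serves as exponent.\<close>

lemma power_of_power_iff_coprime:
  assumes "finite (carrier G)" "a \<in> carrier G"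
  shows "(\<exists>m::nat. m > 0 \<and> a = (a [^] k) [^] m) \<longleftrightarrow> coprime (k::nat) (ord a)"
proof
  assume "\<exists>m::nat. m > 0 \<and> a = (a [^] k) [^] m"
  then obtain m :: nat where m: "a = (a [^] k) [^] m" by blast
  have "a [^] ord (a [^] k) = (a [^] k) [^] (m * ord (a [^] k))"
    by (subst m) (simp add: assms nat_pow_pow mult.assoc)
  also have "\<dots> = \<one>" using assms pow_eq_id by simp
  finally have "ord a dvd ord (a [^] k)" using assms pow_eq_id by simp
  moreover have "ord (a [^] k) dvd ord a"
    using assms by (metis nat_pow_closed nat_pow_pow pow_eq_id mult.commute dvd_triv_left dvd_mult)
  ultimately show "coprime k (ord a)" using pow_ord_eq_ord_iff[OF assms] dvd_antisym by blast
next
  assume cop: "coprime k (ord a)"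
  then obtain m where "[k * m = 1] (mod ord a)" using cong_solve_coprime_nat by auto
  then have "a [^] (k * m) = a [^] (1::nat)"
    using nat_pow_mod_ord[OF assms(2)] by (metis cong_def)
  then have *: "(a [^] k) [^] m = a" using assms by (simp add: nat_pow_pow)
  \<comment> \<open>The inverse \<open>m\<close> may be 0 when \<open>ord a = 1\<close>; adding the
    order of the power makes the exponent positive without changing the result.\<close>
  have "(a [^] k) [^] (m + ord (a [^] k)) = a"
    using assms * by (simp add: nat_pow_mult[symmetric])
  moreover have "m + ord (a [^] k) > 0" using ord_ge_1[of "a [^] k"] assms by simp
  ultimately show "\<exists>m::nat. m > 0 \<and> a = (a [^] k) [^] m" by metis
qed

lemma nontrivial_mutual_powers:
  assumes "finite (carrier G)" "a \<in> carrier G - {\<one>}"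
  shows "{b \<in> carrier G - {\<one>}. (\<exists>m::nat. m > 0 \<and> b = a [^] m) \<and> (\<exists>m::nat. m > 0 \<and> a = b [^] m)}
    = (\<lambda>k. a [^] k) ` totatives (ord a)" (is "?L = _")
proof -
  have a: "a \<in> carrier G" and "ord a \<noteq> 1" using assms ord_eq_1 by auto
  then have ge: "ord a > 1" using ord_ge_1[OF assms(1) a] by simp
  have "?L = {b \<in> {b \<in> carrier G - {\<one>}. \<exists>m::nat. m > 0 \<and> b = a [^] m}. \<exists>m::nat. m > 0 \<and> a = b [^] m}"
    by blast
  also have "\<dots> = (\<lambda>k. a [^] k) ` {k \<in> {1..<ord a}. coprime k (ord a)}"
    unfolding nontrivial_powers[OF assms(1) a]
    using power_of_power_iff_coprime[OF assms(1) a] by blast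
  \<comment> \<open>\<open>totatives\<close> admits the endpoint \<open>ord a\<close>, but above 1
    this is not coprime to itself. For the identity the claim would fail, as 1 is a totative of
    1.\<close>
  also have "{k \<in> {1..<ord a}. coprime k (ord a)} = totatives (ord a)"
    using ge by (auto simp: totatives_def le_less)
  finally show ?thesis .
qed

text \<open>Inclusion-exclusion, with the relation and its converse equally large. The right side is
  shaped so that, in the quotient, its sum is \<open>2 * t\<close>.\<close>

lemma card_power_rel_sym:
  assumes fin: "finite (carrier G)"
  shows "real (card (power_rel G \<union> (power_rel G)\<inverse>)) =
    (\<Sum>a\<in>carrier G. 2 * real (ord a) - real (totient (ord a)) - 1) - (real (order G) - 1)"
proof -
  let ?K = "carrier G - {\<one>}" and ?A = "power_rel G"
  have inj: "inj_on (\<lambda>k. a [^] k) {1..ord a}" if "a \<in> carrier G" for a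
    using ord_inj'[OF that] .
  have A: "?A = Sigma ?K (\<lambda>a. {b \<in> ?K. \<exists>m::nat. m > 0 \<and> b = a [^] m})"
    by (auto simp: power_rel_def)
  have I: "?A \<inter> ?A\<inverse> = Sigma ?K (\<lambda>a. {b \<in> ?K. (\<exists>m::nat. m > 0 \<and> b = a [^] m) \<and> (\<exists>m::nat. m > 0 \<and> a = b [^] m)})"
    by (auto simp: power_rel_def)
  have "card ?A = (\<Sum>a\<in>?K. card {b \<in> ?K. \<exists>m::nat. m > 0 \<and> b = a [^] m})"
    unfolding A using fin by (subst card_SigmaI) auto
  also have "\<dots> = (\<Sum>a\<in>?K. ord a - 1)"
  proof (intro sum.cong refl)
    fix a assume a: "a \<in> ?K"
    have "inj_on (\<lambda>k. a [^] k) {1..<ord a}" using a by (intro inj_on_subset[OF inj]) auto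
    then show "card {b \<in> ?K. \<exists>m::nat. m > 0 \<and> b = a [^] m} = ord a - 1"
      using a unfolding nontrivial_powers[OF fin DiffD1[OF a]] by (simp add: card_image)
  qed
  finally have "real (card ?A) = (\<Sum>a\<in>?K. real (ord a - 1))" by simp
  also have "\<dots> = (\<Sum>a\<in>?K. real (ord a) - 1)"
    using ord_ge_1[OF fin] by (intro sum.cong) (auto simp: of_nat_diff)
  finally have cA: "real (card ?A) = (\<Sum>a\<in>?K. real (ord a) - 1)" .
  have "card (?A \<inter> ?A\<inverse>) = (\<Sum>a\<in>?K. card {b \<in> ?K. (\<exists>m::nat. m > 0 \<and> b = a [^] m) \<and> (\<exists>m::nat. m > 0 \<and> a = b [^] m)})"
    unfolding I using fin by (subst card_SigmaI) auto
  also have "\<dots> = (\<Sum>a\<in>?K. totient (ord a))"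
  proof (intro sum.cong refl)
    fix a assume a: "a \<in> ?K"
    have "totatives (ord a) \<subseteq> {1..ord a}" by (auto simp: totatives_def)
    then have "inj_on (\<lambda>k. a [^] k) (totatives (ord a))" using a by (intro inj_on_subset[OF inj]) auto
    then show "card {b \<in> ?K. (\<exists>m::nat. m > 0 \<and> b = a [^] m) \<and> (\<exists>m::nat. m > 0 \<and> a = b [^] m)} = totient (ord a)"
      unfolding nontrivial_mutual_powers[OF fin a] by (simp add: card_image totient_def)
  qed
  finally have cI: "real (card (?A \<inter> ?A\<inverse>)) = (\<Sum>a\<in>?K. real (totient (ord a)))" by simp
  have "?A \<subseteq> carrier G \<times> carrier G" by (auto simp: power_rel_def)
  then have finA: "finite ?A" using fin finite_subset by blast
  have "card ?A + card (?A\<inverse>) = card (?A \<union> ?A\<inverse>) + card (?A \<inter> ?A\<inverse>)"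
    using finA by (intro card_Un_Int) auto
  then have "real (card (?A \<union> ?A\<inverse>)) = 2 * real (card ?A) - real (card (?A \<inter> ?A\<inverse>))"
    by simp
  \<comment> \<open>Twice \<open>ord a - 1\<close> leaves a constant -2 per element: one unit stays
    in the summand, the other adds up to \<open>card ?K\<close>.\<close>
  also have "\<dots> = (\<Sum>a\<in>?K. 2 * real (ord a) - real (totient (ord a)) - 1 - 1)"
    unfolding cA cI sum_distrib_left sum_subtractf[symmetric] by (intro sum.cong) auto
  also have "\<dots> = (\<Sum>a\<in>?K. 2 * real (ord a) - real (totient (ord a)) - 1) - real (card ?K)"
    by (simp add: sum_subtractf)
  \<comment> \<open>The identity may join the sum, since its term is 2 - 1 - 1 = 0.\<close>
  also have "(\<Sum>a\<in>?K. 2 * real (ord a) - real (totient (ord a)) - 1) =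
      (\<Sum>a\<in>carrier G. 2 * real (ord a) - real (totient (ord a)) - 1)"
    using fin by (simp add: sum.remove[of "carrier G" \<one>])
  also have "real (card ?K) = real (order G) - 1"
    using fin order_gt_0_iff_finite by (auto simp: order_def of_nat_diff card_Diff_singleton)
  finally show ?thesis .
qed

text \<open>Since cosets partition the group, the set is the disjoint union of the rectangles
  \<open>C \<times> D\<close> over the pairs in \<open>S\<close>, each of size
  \<open>(card H)^2\<close>.\<close>

lemma card_coset_pairs:
  assumes "finite (carrier G)" "subgroup H G" "S \<subseteq> (rcosets H) \<times> (rcosets H)"
  shows "card {(x, y). x \<in> carrier G \<and> y \<in> carrier G \<and> (H #> x, H #> y) \<in> S} = card S * (card H)^2"
proof -
  have mem: "C = H #> x" if "C \<in> rcosets H" "x \<in> C" for C x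
    using that repr_independence[OF _ _ assms(2)] by (auto simp: RCOSETS_def)
  have car: "x \<in> carrier G" if "C \<in> rcosets H" "x \<in> C" for C x
    using that rcosets_part_G[OF assms(2)] by blast
  have self: "x \<in> H #> x" if "x \<in> carrier G" for x
    using rcos_self that assms(2) by blast
  have finR: "finite (rcosets H)" 
    using assms(1) by (auto simp: RCOSETS_def)
  then have finS: "finite S" using assms(3) finite_subset by blast
  have "{(x, y). x \<in> carrier G \<and> y \<in> carrier G \<and> (H #> x, H #> y) \<in> S} = (\<Union>p\<in>S. fst p \<times> snd p)"
    (is "?L = ?R")
  proof (intro Set.set_eqI iffI)
    fix z assume "z \<in> ?L"
    then show "z \<in> ?R" using self by force
  next
    fix z assume "z \<in> ?R"
    then obtain C D x y where *: "z = (x, y)" "(C, D) \<in> S" "x \<in> C" "y \<in> D" by force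
    then have "C \<in> rcosets H" "D \<in> rcosets H" using assms(3) by auto
    with * show "z \<in> ?L" using mem car by blast
  qed
  moreover have "card ?R = (\<Sum>p\<in>S. card (fst p \<times> snd p))"
  proof (rule card_UN_disjoint[OF finS])
    show "\<forall>p\<in>S. finite (fst p \<times> snd p)"
    proof
      fix p assume "p \<in> S"
      then have "fst p \<in> rcosets H" "snd p \<in> rcosets H" using assms(3) by auto
      then have "fst p \<subseteq> carrier G" "snd p \<subseteq> carrier G" using car by auto
      then show "finite (fst p \<times> snd p)" using assms(1) by (auto intro: finite_subset)
    qed
    show "\<forall>p\<in>S. \<forall>q\<in>S. p \<noteq> q \<longrightarrow> (fst p \<times> snd p) \<inter> (fst q \<times> snd q) = {}"
    proof (intro ballI impI equals0I)
      fix p q z assume *: "p \<in> S" "q \<in> S" "p \<noteq> q" "z \<in> (fst p \<times> snd p) \<inter> (fst q \<times> snd q)"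
      then have "fst p \<in> rcosets H" "snd p \<in> rcosets H" "fst q \<in> rcosets H" "snd q \<in> rcosets H"
        using assms(3) by auto
      moreover have "fst z \<in> fst p" "fst z \<in> fst q" "snd z \<in> snd p" "snd z \<in> snd q"
        using * by auto
      ultimately have "fst p = fst q" "snd p = snd q" using mem by metis+
      with * show False by (simp add: prod_eq_iff)
    qed
  qed
  moreover have "\<dots> = (\<Sum>p\<in>S. (card H)^2)"
  proof (intro sum.cong refl)
    fix p assume "p \<in> S"
    then have "fst p \<in> rcosets H" "snd p \<in> rcosets H" using assms(3) by auto
    then show "card (fst p \<times> snd p) = (card H)^2"
      using card_rcosets_equal subgroup.subset[OF assms(2)]
      by (metis card_cartesian_product power2_eq_square)
  qed
  ultimately show ?thesis by simp
qed

end

section \<open>Passage from the quotient group to the graph\<close>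

context normal
begin

text \<open>Normality identifies left with right cosets, and the coset of a power is the power of
  the coset, so adjacency becomes a statement inside \<open>G Mod H\<close>.\<close>

lemma nsb_adj_iff:
  assumes "x \<in> carrier G" "y \<in> carrier G"
  shows "nsb_adj G H x y \<longleftrightarrow> x \<noteq> y \<and>
     ((\<exists>m::nat. m > 0 \<and> H #> x = (H #> y) [^]\<^bsub>G Mod H\<^esub> m) \<or>
      (\<exists>m::nat. m > 0 \<and> H #> y = (H #> x) [^]\<^bsub>G Mod H\<^esub> m))"
  using assms by (simp add: nsb_adj_def FactGroup_pow coset_eq[rule_format, symmetric])

text \<open>One set is counted in two ways; the diagonal stands on the left so that no subtraction
  of naturals occurs.\<close>

lemma card_nsb_adj_pairs:
  assumes fin: "finite (carrier G)"
  shows "card {(x, y). x \<in> nsb_verts G H \<and> y \<in> nsb_verts G H \<and> nsb_adj G H x y} + card (carrier G - H)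
    = card (power_rel (G Mod H) \<union> (power_rel (G Mod H))\<inverse>) * (card H)^2 + 2 * card (carrier G - H)"
proof -
  let ?W = "carrier G - H" and ?S = "power_rel (G Mod H) \<union> (power_rel (G Mod H))\<inverse>"
  let ?P = "{(x, y). x \<in> nsb_verts G H \<and> y \<in> nsb_verts G H \<and> nsb_adj G H x y}"
  let ?B = "{(x, y). x \<in> carrier G \<and> y \<in> carrier G \<and> (H #> x, H #> y) \<in> ?S}"
  let ?E = "({\<one>} \<times> ?W) \<union> (?W \<times> {\<one>})"
  interpret Q: group "G Mod H" by (rule factorgroup_is_group)
  have finQ: "finite (carrier (G Mod H))"
    using fin by (auto simp: FactGroup_def RCOSETS_def)
  have coset_in: "H #> x \<in> carrier (G Mod H)" if "x \<in> carrier G" for x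
    using that by (auto simp: FactGroup_def RCOSETS_def)
  have coset_one: "H #> x = H \<longleftrightarrow> x \<in> H" if "x \<in> carrier G" for x
    using that coset_join1[OF _ _ subgroup_axioms] coset_join2[OF _ subgroup_axioms] by blast
  have oneQ: "\<one>\<^bsub>G Mod H\<^esub> = H" by (simp add: FactGroup_def)
  \<comment> \<open>Equal vertices enter because every coset is its own first power.\<close>
  have B_iff: "(x, y) \<in> ?B \<longleftrightarrow> x \<in> ?W \<and> y \<in> ?W \<and> (nsb_adj G H x y \<or> x = y)" for x y
  proof -
    define R where "R C D \<longleftrightarrow> (\<exists>m::nat. m > 0 \<and> C = D [^]\<^bsub>G Mod H\<^esub> m)" for C D
    have refl: "R (H #> x) (H #> x)" if "x \<in> carrier G"
      unfolding R_def using Q.nat_pow_eone[OF coset_in[OF that]] by (intro exI[of _ 1]) simp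
    have S: "(C, D) \<in> ?S \<longleftrightarrow> C \<in> carrier (G Mod H) \<and> D \<in> carrier (G Mod H) \<and>
        C \<noteq> H \<and> D \<noteq> H \<and> (R C D \<or> R D C)" for C D
      unfolding power_rel_def oneQ R_def by blast
    show ?thesis
    proof (cases "x \<in> carrier G \<and> y \<in> carrier G")
      case True
      then have xy: "x \<in> carrier G" "y \<in> carrier G" by auto
      have "(x, y) \<in> ?B \<longleftrightarrow> (H #> x, H #> y) \<in> ?S" using xy by blast
      also have "\<dots> \<longleftrightarrow> x \<notin> H \<and> y \<notin> H \<and> (R (H #> x) (H #> y) \<or> R (H #> y) (H #> x))"
        unfolding S coset_one[OF xy(1)] coset_one[OF xy(2)] using coset_in xy by blast
      finally show ?thesis
        unfolding nsb_adj_iff[OF xy] R_def[symmetric] using refl xy by blast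
    qed blast
  qed
  then have B: "?B = {(x, y). x \<in> ?W \<and> y \<in> ?W \<and> (nsb_adj G H x y \<or> x = y)}"
    by (intro Set.set_eqI) (clarify, simp only: case_prod_conv mem_Collect_eq)
  have one_adj: "nsb_adj G H \<one> x" "nsb_adj G H x \<one>" if x: "x \<in> ?W" for x
  proof -
    have "x \<noteq> \<one>" using x one_closed by auto
    \<comment> \<open>Raising a coset to its order gives the identity coset; finiteness of the
      quotient makes this exponent positive.\<close>
    moreover have "H #> \<one> = (H #> x) [^]\<^bsub>G Mod H\<^esub> Q.ord (H #> x)"
      using x coset_in coset_one[of \<one>] oneQ by auto
    moreover have "Q.ord (H #> x) > 0"
      using Q.ord_ge_1[OF finQ coset_in] x by fastforce
    ultimately show "nsb_adj G H \<one> x" "nsb_adj G H x \<one>"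
      using x by (auto simp: nsb_adj_iff)
  qed
  have irr: "\<not> nsb_adj G H x x" for x by (simp add: nsb_adj_def)
  \<comment> \<open>\<open>?B\<close> holds the adjacent pairs outside \<open>H\<close> together
    with the diagonal, \<open>?E\<close> the pairs with exactly one entry
    \<open>\<one>\<close>.\<close>
  have "?P \<union> (\<lambda>x. (x, x)) ` ?W = ?B \<union> ?E"
    unfolding B nsb_verts_def using one_adj irr by blast
  moreover have "?P \<inter> (\<lambda>x. (x, x)) ` ?W = {}" using irr by auto
  moreover have "?B \<inter> ?E = {}"
    unfolding B by auto
  moreover have "finite ?P" "finite ?B"
    by (rule finite_subset[of _ "carrier G \<times> carrier G"], use fin in \<open>auto simp: nsb_verts_def\<close>)+
  ultimately have "card ?P + card ((\<lambda>x. (x, x)) ` ?W) = card ?B + card ?E"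
    using fin card_Un_disjoint[of ?P "(\<lambda>x. (x, x)) ` ?W"] card_Un_disjoint[of ?B ?E] by simp
  moreover have "card ((\<lambda>x. (x, x)) ` ?W) = card ?W" by (rule card_image) (auto simp: inj_on_def)
  moreover have "card ?E = 2 * card ?W"
    using fin by (subst card_Un_disjoint) (auto simp: card_cartesian_product)
  moreover have "card ?B = card ?S * (card H)^2"
    by (rule card_coset_pairs[OF fin subgroup_axioms]) (auto simp: power_rel_def FactGroup_def)
  ultimately show ?thesis by simp
qed

end

theorem theorem6p1:
  fixes G (structure) and H :: "'a set" and n :: nat and t :: real
  assumes "group G"
    and "finite (carrier G)"
    and "H \<lhd> G"
    and "H \<noteq> {\<one>\<^bsub>G\<^esub>}"
    and "n = order (G Mod H)"
    and "t = (1 / 2) * (\<Sum>C\<in>carrier (G Mod H).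
           2 * real (group.ord (G Mod H) C) - real (totient (group.ord (G Mod H) C)) - 1)"
  shows "real (card (nsb_edges G H)) =
     (t - real n + 1) * real (card H) ^ 2
     + real (card H choose 2) * (real (order G) / real (card H) - 1)
     + (real (order G) - real (card H))"
proof -
  interpret normal H G by fact
  interpret Q: group "G Mod H" by (rule factorgroup_is_group)
  let ?h = "real (card H)"
  let ?P = "{(x, y). x \<in> nsb_verts G H \<and> y \<in> nsb_verts G H \<and> nsb_adj G H x y}"
  have finH: "finite H" using assms(2) subset finite_subset by blast
  moreover have "H \<noteq> {}" using subgroup.one_closed[OF subgroup_axioms] by blast
  ultimately have h: "?h > 0" by (simp add: card_gt_0_iff)
  have "finite (carrier (G Mod H))"
    using assms(2) by (auto simp: FactGroup_def RCOSETS_def)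
  from Q.card_power_rel_sym[OF this] assms(5,6)
  have S: "real (card (power_rel (G Mod H) \<union> (power_rel (G Mod H))\<inverse>)) = 2 * t - (real n - 1)"
    by simp
  have "n * card H = order G"
    using lagrange_finite[OF assms(2) subgroup_axioms] assms(5)
    by (simp add: order_def FactGroup_def mult.commute)
  then have oG: "real (order G) = real n * ?h" by (metis of_nat_mult)
  have W: "real (card (carrier G - H)) = real n * ?h - ?h"
    using card_Diff_subset[OF finH subset] card_mono[OF assms(2) subset] oG
    by (simp add: order_def of_nat_diff)
  have "finite ?P"
    by (rule finite_subset[of _ "carrier G \<times> carrier G"], use assms(2) in \<open>auto simp: nsb_verts_def\<close>)
  moreover have "sym ?P" "irrefl ?P" by (auto simp: nsb_adj_def sym_def irrefl_def)
  ultimately have "card ?P = 2 * card {{x, y} | x y. (x, y) \<in> ?P}" by (rule card_sym_irrefl)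
  also have "{{x, y} | x y. (x, y) \<in> ?P} = nsb_edges G H" by (simp add: nsb_edges_def)
  finally have P: "real (card ?P) = 2 * real (card (nsb_edges G H))" by simp
  have "real (card ?P) + real (card (carrier G - H)) =
      real (card (power_rel (G Mod H) \<union> (power_rel (G Mod H))\<inverse>)) * ?h^2
      + 2 * real (card (carrier G - H))"
    using arg_cong[OF card_nsb_adj_pairs[OF assms(2)], of real] by simp
  then have main: "2 * real (card (nsb_edges G H)) = (2 * t - (real n - 1)) * ?h^2 + (real n * ?h - ?h)"
    unfolding P W S by (simp add: algebra_simps)
  \<comment> \<open>The case split removes the truncated subtraction
    \<open>card H - 1\<close>.\<close>
  have ch: "real (card H choose 2) = ?h * (?h - 1) / 2"
    by (cases "card H") (simp_all add: choose_two real_of_nat_div algebra_simps)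
  show ?thesis
    \<comment> \<open>Of the \<open>2 * t - (n - 1)\<close> related coset pairs,
      \<open>n - 1\<close> are loops, leaving \<open>t - n + 1\<close> unordered pairs of distinct
      cosets. The loops yield the binomial term: the edges inside each nontrivial coset.\<close>
    using main h unfolding oG ch by (simp add: field_simps power2_eq_square)
qed

end
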